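(* Let $G$ be a first countable Hausdorff topological group, let $H$ be a dense countable subgroup of $G$, let $(X,d)$ be a compact metric space, and let $\Phi\in\operatorname{Act}(G,X)$. If $\Phi$ is equicontinuous, then the set $P(\Phi)$ of all $\beta$-persistent points of $\Phi$ is a closed subset of $X$.
   Context: $\operatorname{Act}(G,X)$ denotes the set of all continuous maps $\Phi:G\times X\to X$ such that, writing $\Phi_g=\Phi(g,\cdot)$, each $\Phi_g$ is a homeomorphism of $X$, $\Phi_e=\mathrm{id}_X$ for the identity $e\in G$, and $\Phi_g\circ\Phi_h=\Phi_{gh}$ for all $g,h\in G$. For $\Phi,\Psi\in\operatorname{Act}(G,X)$ put $d_H(\Phi,\Psi)=\sup_{h\in H,\,x\in X} d(\Phi_h(x),\Psi_h(x))$. $\Phi$ is equicontinuous (with respect to $H$) if for each $\epsilon>0$ there is $\delta>0$ such that $x,y\in X$ and $d(x,y)\le\delta$ imply $d(\Phi_h(x),\Phi_h(y))\le\epsilon$ for each $h\in H$. A point $x\in X$ is a $\beta$-persistent point of $\Phi$ (with respect to $H$) if for each $\epsilon>0$ there is $\delta>0$ such that for each $\Psi\in\operatorname{Act}(G,X)$ with $d_H(\Phi,\Psi)\le\delta$ there is $y\in X$ with $d(\Phi_g(x),\Psi_g(y))\le\epsilon$ for each $g\in G$. $P(\Phi)$ is the set of all $\beta$-persistent points of $\Phi$. *)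

theory Defs
  imports "HOL-Analysis.Analysis"
begin

text \<open>
  Topological groups are rendered by the type class \<open>topological_group_add\<close>. It is
  written additively, but \<open>group_add\<close> does not assume commutativity: \<open>g + h\<close>,
  \<open>0\<close>, \<open>- g\<close> stand for the product, the identity and the inverse.
\<close>

definition add_subgroup :: "'g::group_add set \<Rightarrow> bool" where
  "add_subgroup H \<longleftrightarrow>
     0 \<in> H \<and> (\<forall>g\<in>H. \<forall>h\<in>H. g + h \<in> H) \<and> (\<forall>g\<in>H. - g \<in> H)"

definition Act :: "('g::topological_group_add \<Rightarrow> 'x::metric_space \<Rightarrow> 'x) set" where
  "Act = {\<Phi>. continuous_on UNIV (\<lambda>(g, x). \<Phi> g x)
            \<and> (\<forall>g. \<exists>f'. homeomorphism UNIV UNIV (\<Phi> g) f')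
            \<and> \<Phi> 0 = id
            \<and> (\<forall>g h. \<Phi> g \<circ> \<Phi> h = \<Phi> (g + h))}"

text \<open>
  The supremum is taken in the reals; for compact \<open>'x\<close> and nonempty \<open>H\<close> it is the
  supremum of a nonempty bounded set.
\<close>

definition dist_act ::
  "'g set \<Rightarrow> ('g \<Rightarrow> 'x::metric_space \<Rightarrow> 'x) \<Rightarrow> ('g \<Rightarrow> 'x \<Rightarrow> 'x) \<Rightarrow> real" where
  "dist_act H \<Phi> \<Psi> = (SUP (h, x) \<in> H \<times> UNIV. dist (\<Phi> h x) (\<Psi> h x))"

definition equicontinuous_act ::
  "'g set \<Rightarrow> ('g \<Rightarrow> 'x::metric_space \<Rightarrow> 'x) \<Rightarrow> bool" where
  "equicontinuous_act H \<Phi> \<longleftrightarrow>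
     (\<forall>\<epsilon>>0. \<exists>\<delta>>0. \<forall>x y. dist x y \<le> \<delta> \<longrightarrow> (\<forall>h\<in>H. dist (\<Phi> h x) (\<Phi> h y) \<le> \<epsilon>))"

definition beta_persistent_point ::
  "'g::topological_group_add set \<Rightarrow> ('g \<Rightarrow> 'x::metric_space \<Rightarrow> 'x) \<Rightarrow> 'x \<Rightarrow> bool" where
  "beta_persistent_point H \<Phi> x \<longleftrightarrow>
     (\<forall>\<epsilon>>0. \<exists>\<delta>>0. \<forall>\<Psi>\<in>Act. dist_act H \<Phi> \<Psi> \<le> \<delta> \<longrightarrow>
        (\<exists>y. \<forall>g. dist (\<Phi> g x) (\<Psi> g y) \<le> \<epsilon>))"

definition persistent_points ::
  "'g::topological_group_add set \<Rightarrow> ('g \<Rightarrow> 'x::metric_space \<Rightarrow> 'x) \<Rightarrow> 'x set" where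
  "persistent_points H \<Phi> = {x. beta_persistent_point H \<Phi> x}"

end

theory Submission
  imports Defs
begin

text \<open>Let z be a limit of persistent points. By equicontinuity, a persistent point x close
  enough to z has its whole \<Phi>-orbit within \<epsilon>/2 of that of z. If \<Psi> is so close to
  \<Phi> that some y has its \<Psi>-orbit within \<epsilon>/2 of the \<Phi>-orbit of x, then by the
  triangle inequality the same y follows z within \<epsilon>, so z is persistent. One gap remains:
  equicontinuity speaks of times in H, whereas persistence compares orbits at all times in the
  group. \<open>equicontinuous_act_dense\<close> closes it, using the density of H and the
  continuity of orbit maps.\<close>

lemma Act_continuous_orbit:
  assumes "\<Phi> \<in> Act"
  shows "continuous_on UNIV (\<lambda>g. \<Phi> g x)"
proof -
  have "continuous_on UNIV (\<lambda>(g, x). \<Phi> g x)"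
    using assms by (simp add: Act_def)
  moreover have "continuous_on UNIV (\<lambda>g. (g, x))"
    by (intro continuous_intros)
  ultimately show ?thesis
    using continuous_on_compose2[of UNIV "\<lambda>(g, x). \<Phi> g x" UNIV "\<lambda>g. (g, x)"] by simp
qed

text \<open>For fixed points and \<epsilon>, a non-strict bound between continuous functions of g
  holds on a closed set of g; once this set contains H, it is the whole group. Thus each \<delta>
  that serves H serves all g, with no loss in \<epsilon>.\<close>

lemma equicontinuous_act_dense:
  fixes \<Phi> :: "'g::topological_group_add \<Rightarrow> 'x::metric_space \<Rightarrow> 'x"
  assumes "equicontinuous_act H \<Phi>" "closure H = UNIV" "\<Phi> \<in> Act"
  shows "equicontinuous_act UNIV \<Phi>"
proof -
  have "dist (\<Phi> g x) (\<Phi> g y) \<le> \<epsilon>"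
    if le: "\<forall>h\<in>H. dist (\<Phi> h x) (\<Phi> h y) \<le> \<epsilon>" for g x y \<epsilon>
  proof -
    have "closed {g. dist (\<Phi> g x) (\<Phi> g y) \<le> \<epsilon>}"
      by (intro closed_Collect_le continuous_intros Act_continuous_orbit assms(3))
    then have "closure H \<subseteq> {g. dist (\<Phi> g x) (\<Phi> g y) \<le> \<epsilon>}"
      using le by (intro closure_minimal) auto
    then show ?thesis
      using assms(2) by auto
  qed
  note extend = this
  show ?thesis
    unfolding equicontinuous_act_def
  proof (intro allI impI)
    fix \<epsilon> :: real
    assume "\<epsilon> > 0"
    then obtain \<delta> where "\<delta> > 0"
      and "\<forall>x y. dist x y \<le> \<delta> \<longrightarrow> (\<forall>h\<in>H. dist (\<Phi> h x) (\<Phi> h y) \<le> \<epsilon>)"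
      using assms(1) unfolding equicontinuous_act_def by blast
    with extend show "\<exists>\<delta>>0. \<forall>x y. dist x y \<le> \<delta> \<longrightarrow>
        (\<forall>h\<in>UNIV. dist (\<Phi> h x) (\<Phi> h y) \<le> \<epsilon>)"
      by (intro exI[of _ \<delta>]) simp
  qed
qed

theorem lemma3p19:
  fixes H :: "'g::{topological_group_add, first_countable_topology, t2_space} set"
    and \<Phi> :: "'g \<Rightarrow> 'x::metric_space \<Rightarrow> 'x"
  assumes "add_subgroup H" and "countable H" and "closure H = UNIV"
    and "compact (UNIV :: 'x set)"
    and "\<Phi> \<in> Act"
    and "equicontinuous_act H \<Phi>"
  shows "closed (persistent_points H \<Phi>)"
proof -
  have "z \<in> persistent_points H \<Phi>" if z: "z \<in> closure (persistent_points H \<Phi>)" for z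
    unfolding persistent_points_def beta_persistent_point_def mem_Collect_eq
  proof (intro allI impI)
    fix \<epsilon> :: real
    assume "\<epsilon> > 0"
    then have half: "\<epsilon> / 2 > 0"
      by simp
    have "\<forall>\<epsilon>>0. \<exists>\<eta>>0. \<forall>x y. dist x y \<le> \<eta> \<longrightarrow> (\<forall>g\<in>UNIV. dist (\<Phi> g x) (\<Phi> g y) \<le> \<epsilon>)"
      using equicontinuous_act_dense[OF assms(6,3,5)] unfolding equicontinuous_act_def .
    from this[rule_format, OF half] obtain \<eta> where "\<eta> > 0"
      and \<eta>: "\<And>x y g. dist x y \<le> \<eta> \<Longrightarrow> dist (\<Phi> g x) (\<Phi> g y) \<le> \<epsilon> / 2"
      by auto
    \<comment> \<open>This x depends only on z and \<epsilon>. The \<delta> that its persistence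
      gives for \<epsilon>/2 is therefore fixed before any \<Psi> is considered, and can be used as
      the \<delta> for z.\<close>
    obtain x where x: "x \<in> persistent_points H \<Phi>" "dist x z < \<eta>"
      using closure_approachable[THEN iffD1, OF z] \<open>\<eta> > 0\<close> by auto
    have "\<forall>\<epsilon>>0. \<exists>\<delta>>0. \<forall>\<Psi>\<in>Act. dist_act H \<Phi> \<Psi> \<le> \<delta> \<longrightarrow>
        (\<exists>y. \<forall>g. dist (\<Phi> g x) (\<Psi> g y) \<le> \<epsilon>)"
      using x(1) by (simp only: persistent_points_def beta_persistent_point_def mem_Collect_eq)
    from this[rule_format, OF half] obtain \<delta> where "\<delta> > 0"
      and \<delta>: "\<And>\<Psi>. \<Psi> \<in> Act \<Longrightarrow> dist_act H \<Phi> \<Psi> \<le> \<delta> \<Longrightarrow>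
        \<exists>y. \<forall>g. dist (\<Phi> g x) (\<Psi> g y) \<le> \<epsilon> / 2"
      by auto
    have "\<exists>y. \<forall>g. dist (\<Phi> g z) (\<Psi> g y) \<le> \<epsilon>"
      if "\<Psi> \<in> Act" "dist_act H \<Phi> \<Psi> \<le> \<delta>" for \<Psi>
    proof -
      obtain y where y: "\<And>g. dist (\<Phi> g x) (\<Psi> g y) \<le> \<epsilon> / 2"
        using \<delta>[OF \<open>\<Psi> \<in> Act\<close> \<open>dist_act H \<Phi> \<Psi> \<le> \<delta>\<close>] by blast
      have "dist (\<Phi> g z) (\<Psi> g y) \<le> \<epsilon>" for g
        \<comment> \<open>The intermediate point is \<Phi> g x: it is within \<epsilon>/2 of \<Phi>
          g z by the choice of \<eta>, and within \<epsilon>/2 of \<Psi> g y by the choice of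
          y.\<close>
        using dist_triangle3[of "\<Phi> g z" "\<Psi> g y" "\<Phi> g x"] y[of g] \<eta>[of x z g] x(2) by linarith
      then show ?thesis
        by blast
    qed
    with \<open>\<delta> > 0\<close> show "\<exists>\<delta>>0. \<forall>\<Psi>\<in>Act. dist_act H \<Phi> \<Psi> \<le> \<delta> \<longrightarrow>
        (\<exists>y. \<forall>g. dist (\<Phi> g z) (\<Psi> g y) \<le> \<epsilon>)"
      by blast
  qed
  then have "closure (persistent_points H \<Phi>) \<subseteq> persistent_points H \<Phi>"
    by (rule subsetI)
  then show ?thesis
    by (simp only: closure_subset_eq)
qed

end
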